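(* Let $n,d,T\ge 1$ be integers, let $G_\infty>0$, and let $f_1,\dots,f_n:\mathbb{R}^d\to\mathbb{R}$ each be convex and $G_\infty$-Lipschitz with respect to the $\ell_1$-norm, i.e. $|f_i(x)-f_i(y)|\le G_\infty\|x-y\|_1$ for all $x,y\in\mathbb{R}^d$. Let $f=\frac1n\sum_{i=1}^n f_i$ and let $x_*$ be a global minimizer of $f$ over $\mathbb{R}^d$. Let $x_1\in\mathbb{R}^d$ be deterministic, $\gamma=\frac{\|x_1-x_*\|}{\sqrt{dT}}$, and let $(x_t)$ be generated by the SignSGD+ recursion $$x_{t+1}=x_t-\gamma\,\mathrm{sign}(g_t+G_\infty U_t),\qquad t=1,\dots,T,$$ described in the context. Then, with $\bar x_T=\frac1T\sum_{t=1}^T x_t$, $$\mathbb{E}[f(\bar x_T)]-f(x_* )\le G_\infty\|x_1-x_*\|\sqrt{\frac dT}.$$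
   Context: $\|\cdot\|$ is the Euclidean norm, $\|\cdot\|_1$ the $\ell_1$-norm; $\mathrm{sign}$ acts coordinate-wise. In the SignSGD+ recursion, at each step $t$: $i_t$ is uniformly distributed on $\{1,\dots,n\}$ and independent of the past (in particular of $x_t$); $g_t$ is a subgradient of $f_{i_t}$ at $x_t$ (determined by $x_t$ and $i_t$ through a fixed measurable selection); $U_t$ is uniformly distributed on $[-1,1]^d$ and independent of the past and of $x_t,i_t$. *)

theory Defs
  imports "HOL-Probability.Probability"
begin

definition l1_norm :: "real ^ 'd \<Rightarrow> real" where
  "l1_norm v = (\<Sum>j\<in>UNIV. \<bar>v $ j\<bar>)"

(* The overloaded sgn on real ^ 'd is v / norm v, hence a separate constant. *)
definition sign_vec :: "real ^ 'd \<Rightarrow> real ^ 'd" where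
  "sign_vec v = (\<chi> j. sgn (v $ j))"

definition subgradient :: "('a::real_inner \<Rightarrow> real) \<Rightarrow> 'a \<Rightarrow> 'a \<Rightarrow> bool" where
  "subgradient h x v \<longleftrightarrow> (\<forall>y. h y \<ge> h x + v \<bullet> (y - x))"

definition cube :: "(real ^ 'd) set" where
  "cube = cbox (\<chi> j. - 1) (\<chi> j. 1)"

definition avg_fun :: "nat \<Rightarrow> (nat \<Rightarrow> 'a \<Rightarrow> real) \<Rightarrow> 'a \<Rightarrow> real" where
  "avg_fun n f x = (1 / real n) * (\<Sum>i=1..n. f i x)"

definition avg_iterate :: "nat \<Rightarrow> (nat \<Rightarrow> 'w \<Rightarrow> 'a::real_vector) \<Rightarrow> 'w \<Rightarrow> 'a" where
  "avg_iterate T x \<omega> = (1 / real T) *\<^sub>R (\<Sum>t=1..T. x t \<omega>)"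

(* All randomness drawn before step t.  With a deterministic starting point and a
   subgradient chosen by a fixed measurable selection, the iterates x 1, ..., x t
   are functions of it. *)
definition past ::
  "(nat \<Rightarrow> 'w \<Rightarrow> nat) \<Rightarrow> (nat \<Rightarrow> 'w \<Rightarrow> real ^ 'd) \<Rightarrow> nat \<Rightarrow> 'w \<Rightarrow> (nat \<Rightarrow> nat \<times> (real ^ 'd))" where
  "past idx U t \<omega> = (\<lambda>s\<in>{1..<t}. (idx s \<omega>, U s \<omega>))"

definition past_space :: "nat \<Rightarrow> nat \<Rightarrow> (nat \<Rightarrow> nat \<times> (real ^ 'd)) measure" where
  "past_space n t = PiM {1..<t} (\<lambda>_. count_space {1..n} \<Otimes>\<^sub>M borel)"

(* prob_space.indep_var requires both random variables to have the same value type;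
   this is the same notion (independence of the generated sigma-algebras) without
   that restriction. *)
definition indep_rv ::
  "'w measure \<Rightarrow> 'a measure \<Rightarrow> ('w \<Rightarrow> 'a) \<Rightarrow> 'b measure \<Rightarrow> ('w \<Rightarrow> 'b) \<Rightarrow> bool" where
  "indep_rv M N X N' Y \<longleftrightarrow>
     X \<in> measurable M N \<and> Y \<in> measurable M N' \<and>
     prob_space.indep_set M (sets (vimage_algebra (space M) X N))
                            (sets (vimage_algebra (space M) Y N'))"

end

theory Submission imports Defs begin

text \<open>
  The dithering noise makes the sign an unbiased gradient estimate: as every
  subgradient coordinate \<open>a\<close> satisfies \<open>\<bar>a\<bar> \<le> G\<close>, averaging
  \<open>sgn (a + G u)\<close> over \<open>u\<close> uniform on \<open>[-1, 1]\<close> gives \<open>a / G\<close>. The recursion is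
  therefore stochastic subgradient descent with directions of norm at most \<open>sqrt d\<close>, and
  expanding \<open>norm (x (t + 1) - x_star)\<^sup>2\<close>, telescoping, and applying Jensen's inequality
  gives the bound.
\<close>

subsection \<open>Independence\<close>

text \<open>Independence gives the product formula on preimages of measurable rectangles, and
  rectangles determine a product of sigma-finite measures. The joint law is thus a product, ready
  for Fubini.\<close>

lemma distr_indep_rv:
  assumes M: "prob_space M" and ind: "indep_rv M N X N' Y"
  shows "distr M (N \<Otimes>\<^sub>M N') (\<lambda>\<omega>. (X \<omega>, Y \<omega>)) = distr M N X \<Otimes>\<^sub>M distr M N' Y"
proof -
  interpret prob_space M by fact
  have X[measurable]: "X \<in> measurable M N" and Y[measurable]: "Y \<in> measurable M N'"
    and indep: "indep_set (sets (vimage_algebra (space M) X N)) (sets (vimage_algebra (space M) Y N'))"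
    using ind by (auto simp: indep_rv_def)
  interpret DX: prob_space "distr M N X" by (rule prob_space_distr) fact
  interpret DY: prob_space "distr M N' Y" by (rule prob_space_distr) fact
  show ?thesis
  proof (rule pair_measure_eqI[symmetric])
    fix A B assume "A \<in> sets (distr M N X)" "B \<in> sets (distr M N' Y)"
    then have A[measurable]: "A \<in> sets N" and B[measurable]: "B \<in> sets N'" by auto
    have "prob ((X -` A \<inter> space M) \<inter> (Y -` B \<inter> space M))
        = prob (X -` A \<inter> space M) * prob (Y -` B \<inter> space M)"
      by (intro indep_setD[OF indep] in_vimage_algebra A B)
    moreover have "(\<lambda>\<omega>. (X \<omega>, Y \<omega>)) -` (A \<times> B) \<inter> space M
        = (X -` A \<inter> space M) \<inter> (Y -` B \<inter> space M)" by auto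
    ultimately show "emeasure (distr M N X) A * emeasure (distr M N' Y) B
        = emeasure (distr M (N \<Otimes>\<^sub>M N') (\<lambda>\<omega>. (X \<omega>, Y \<omega>))) (A \<times> B)"
      by (simp add: emeasure_distr emeasure_eq_measure ennreal_mult)
  qed (simp_all add: sets_pair_measure_cong[OF sets_distr sets_distr]
         DX.sigma_finite_measure_axioms DY.sigma_finite_measure_axioms)
qed

lemma expectation_indep_rv:
  fixes h :: "'b \<Rightarrow> 'a \<Rightarrow> real"
  assumes M: "prob_space M" and ind: "indep_rv M N X N' Y"
    and h: "(\<lambda>(a, b). h b a) \<in> borel_measurable (N \<Otimes>\<^sub>M N')"
    and bound: "\<And>a b. a \<in> space N \<Longrightarrow> b \<in> space N' \<Longrightarrow> \<bar>h b a\<bar> \<le> C"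
  shows "(\<integral>\<omega>. h (Y \<omega>) (X \<omega>) \<partial>M) = (\<integral>\<omega>. (\<integral>a. h (Y \<omega>) a \<partial>distr M N X) \<partial>M)"
proof -
  interpret prob_space M by fact
  have X[measurable]: "X \<in> measurable M N" and Y[measurable]: "Y \<in> measurable M N'"
    using ind by (auto simp: indep_rv_def)
  interpret DX: prob_space "distr M N X" by (rule prob_space_distr) fact
  interpret DY: prob_space "distr M N' Y" by (rule prob_space_distr) fact
  interpret P: pair_prob_space "distr M N X" "distr M N' Y" ..
  have h'[measurable]: "(\<lambda>(a, b). h b a) \<in> borel_measurable (distr M N X \<Otimes>\<^sub>M distr M N' Y)"
    using h by (simp cong: measurable_cong_sets add: sets_pair_measure_cong[OF sets_distr sets_distr])
  \<comment> \<open>The swapped argument order is what yields measurability in \<open>b\<close> of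
    the inner integral over the law of \<open>X\<close>.\<close>
  have h2: "(\<lambda>(b, a). h b a) \<in> borel_measurable (N' \<Otimes>\<^sub>M distr M N X)"
    using measurable_pair_swap[OF h]
    by (simp cong: measurable_cong_sets add: sets_pair_measure_cong[OF refl sets_distr] case_prod_beta)
  have "integrable (distr M N X \<Otimes>\<^sub>M distr M N' Y) (\<lambda>(a, b). h b a)"
    by (rule P.integrable_const_bound[where B=C])
       (use bound h' in \<open>auto simp: space_pair_measure\<close>)
  note int = P.integral_snd[OF this]
  have "(\<integral>\<omega>. h (Y \<omega>) (X \<omega>) \<partial>M)
      = (\<integral>z. (\<lambda>(a, b). h b a) z \<partial>distr M (N \<Otimes>\<^sub>M N') (\<lambda>\<omega>. (X \<omega>, Y \<omega>)))"
    by (subst integral_distr) (use h in auto)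
  also have "\<dots> = (\<integral>b. (\<integral>a. h b a \<partial>distr M N X) \<partial>distr M N' Y)"
    using int by (simp add: distr_indep_rv[OF M ind])
  also have "\<dots> = (\<integral>\<omega>. (\<integral>a. h (Y \<omega>) a \<partial>distr M N X) \<partial>M)"
    by (rule integral_distr) (auto intro!: DX.borel_measurable_lebesgue_integral h2)
  finally show ?thesis .
qed

subsection \<open>Dithered signs\<close>

lemma norm_sign_vec_power2_le: "(norm (sign_vec v))\<^sup>2 \<le> real CARD('d)" for v :: "real ^ 'd"
proof -
  have "(norm (sign_vec v))\<^sup>2 = (\<Sum>j\<in>UNIV. (sgn (v $ j))\<^sup>2)"
    unfolding power2_norm_eq_inner inner_vec_def by (simp add: sign_vec_def power2_eq_square)
  also have "\<dots> \<le> (\<Sum>j\<in>(UNIV :: 'd set). 1)" by (intro sum_mono) (simp add: sgn_if)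
  finally show ?thesis by simp
qed

lemma norm_sign_vec_le: "norm (sign_vec v) \<le> sqrt (real CARD('d))" for v :: "real ^ 'd"
  using norm_sign_vec_power2_le[of v] by (rule real_le_rsqrt)

lemma measurable_sign_vec[measurable]: "(sign_vec :: real ^ 'd \<Rightarrow> _) \<in> borel_measurable borel"
proof -
  have "(\<lambda>v. sign_vec v \<bullet> b) \<in> borel_measurable borel" if "b \<in> Basis" for b :: "real ^ 'd"
  proof -
    from that obtain j where b: "b = axis j 1" by (metis axis_index)
    have "(\<lambda>v :: real ^ 'd. sgn (v $ j)) \<in> borel_measurable borel"
      by (rule measurable_compose[OF _ borel_measurable_sgn])
         (intro borel_measurable_continuous_onI continuous_intros)
    then show ?thesis unfolding b inner_axis sign_vec_def by simp
  qed
  then show ?thesis by (subst borel_measurable_euclidean_space) auto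
qed

lemma prob_space_uniform_cube: "prob_space (uniform_measure lborel (cube :: (real ^ 'd) set))"
  and measure_cube: "measure lborel (cube :: (real ^ 'd) set) = 2 ^ CARD('d)"
proof -
  have ne: "cube \<noteq> ({} :: (real ^ 'd) set)" by (simp add: cube_def interval_eq_empty_cart)
  then show m: "measure lborel (cube :: (real ^ 'd) set) = 2 ^ CARD('d)"
    unfolding cube_def by (subst content_cbox_cart) auto
  show "prob_space (uniform_measure lborel (cube :: (real ^ 'd) set))"
    by (rule prob_space_uniform_measure)
       (use m in \<open>auto simp: cube_def emeasure_lborel_cbox_eq measure_def\<close>)
qed

text \<open>A slab in direction \<open>j\<close> cuts the cube in a box of side \<open>1 + c\<close>
  or \<open>1 - c\<close> along \<open>j\<close> and side 2 along every other axis, so all factors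
  except one cancel against the volume of the cube. Both half-spaces are closed, which makes both
  intersections a \<open>cbox\<close>.\<close>

lemma measure_uniform_cube_component:
  fixes j :: "'d::finite"
  assumes c: "\<bar>c\<bar> \<le> 1"
  shows "measure (uniform_measure lborel cube) {u :: real ^ 'd. u $ j \<le> c} = (1 + c) / 2"
    and "measure (uniform_measure lborel cube) {u :: real ^ 'd. c \<le> u $ j} = (1 - c) / 2"
proof -
  have fin: "emeasure lborel (cube :: (real ^ 'd) set) \<noteq> \<infinity>"
    unfolding cube_def by (simp add: emeasure_lborel_cbox_eq)
  have pos: "emeasure lborel (cube :: (real ^ 'd) set) \<noteq> 0"
    using measure_cube[where 'd='d] by (auto simp: measure_def)
  \<comment> \<open>Common to both slabs: only the side length \<open>l\<close> along
    \<open>j\<close> differs from that of the cube.\<close>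
  have half: "measure (uniform_measure lborel cube) A = l / 2"
    if A: "A \<in> sets borel" and eq: "cube \<inter> A = cbox a b" 
      and le: "\<And>i. a $ i \<le> b $ i"
      and l: "b $ j - a $ j = l" and other: "\<And>i. i \<noteq> j \<Longrightarrow> b $ i - a $ i = 2"
    for A :: "(real ^ 'd) set" and a b :: "real ^ 'd" and l
  proof -
    have "measure lborel (cbox a b) = (\<Prod>i\<in>UNIV. b $ i - a $ i)"
      by (rule content_cbox_cart) (use le in \<open>auto simp: interval_eq_empty_cart not_less\<close>)
    also have "\<dots> = l * (\<Prod>i\<in>UNIV - {j}. b $ i - a $ i)"
      by (subst prod.remove[of _ j]) (auto simp: l)
    also have "(\<Prod>i\<in>UNIV - {j}. b $ i - a $ i) = (\<Prod>i\<in>UNIV - {j}. 2)"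
      by (rule prod.cong) (auto simp: other)
    finally have "measure lborel (cbox a b) = l * 2 ^ (CARD('d) - 1)" by simp
    moreover have "(2::real) ^ CARD('d) = 2 * 2 ^ (CARD('d) - 1)"
      by (cases "CARD('d)") auto
    ultimately show ?thesis
      using A fin pos by (subst measure_uniform_measure) (auto simp: eq measure_cube)
  qed
  have meas: "(\<lambda>u :: real ^ 'd. u $ j) \<in> borel_measurable borel"
    by (intro borel_measurable_continuous_onI continuous_intros)
  have c': "- 1 \<le> c" "c \<le> 1" using c by auto
  show "measure (uniform_measure lborel cube) {u :: real ^ 'd. u $ j \<le> c} = (1 + c) / 2"
  proof (rule half[where a = "\<chi> i. - 1" and b = "\<chi> i. if i = j then c else 1"])
    show "cube \<inter> {u :: real ^ 'd. u $ j \<le> c} = cbox (\<chi> i. - 1) (\<chi> i. if i = j then c else 1)"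
      using c' unfolding cube_def set_eq_iff by (simp add: mem_box_cart) (smt (verit))
  qed (use c' meas in auto)
  show "measure (uniform_measure lborel cube) {u :: real ^ 'd. c \<le> u $ j} = (1 - c) / 2"
  proof (rule half[where a = "\<chi> i. if i = j then c else - 1" and b = "\<chi> i. 1"])
    show "cube \<inter> {u :: real ^ 'd. c \<le> u $ j} = cbox (\<chi> i. if i = j then c else - 1) (\<chi> i. 1)"
      using c' unfolding cube_def set_eq_iff by (simp add: mem_box_cart) (smt (verit))
  qed (use c' meas in auto)
qed

text \<open>The sign flips at the threshold \<open>c = - a / G\<close>, which lies in [-1, 1]
  because \<open>\<bar>a\<bar> \<le> G\<close>. The mean is the mass above \<open>c\<close> minus
  the mass below, (1 - c)/2 - (1 + c)/2 = -c.\<close>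

lemma integral_dithered_sgn:
  fixes j :: "'d::finite"
  assumes G: "G > 0" and a: "\<bar>a\<bar> \<le> G"
  shows "(\<integral>u. sgn (a + G * (u :: real ^ 'd) $ j) \<partial>uniform_measure lborel cube) = a / G"
proof -
  interpret prob_space "uniform_measure lborel (cube :: (real ^ 'd) set)"
    by (rule prob_space_uniform_cube)
  define c where "c = - a / G"
  have c: "\<bar>c\<bar> \<le> 1" using G a by (simp add: c_def abs_divide)
  \<comment> \<open>At \<open>v = c\<close> both indicators equal 1 and cancel, in agreement with
    \<open>sgn 0 = 0\<close>. The identity is therefore pointwise, with no exceptional null
    set.\<close>
  have sgn: "sgn (a + G * v) = indicator {c..} v - indicator {..c} v" for v
    using G by (auto simp: c_def sgn_if indicator_def field_simps)
  have "(\<integral>u. sgn (a + G * (u :: real ^ 'd) $ j) \<partial>uniform_measure lborel cube)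
     = (\<integral>u. indicator {u. c \<le> u $ j} u - indicator {u :: real ^ 'd. u $ j \<le> c} u
          \<partial>uniform_measure lborel cube)"
    unfolding sgn by (intro Bochner_Integration.integral_cong) (auto simp: indicator_def)
  also have "\<dots> = measure (uniform_measure lborel cube) {u :: real ^ 'd. c \<le> u $ j}
      - measure (uniform_measure lborel cube) {u :: real ^ 'd. u $ j \<le> c}"
    by (subst Bochner_Integration.integral_diff)
       (auto intro!: integrable_real_indicator simp: less_top[symmetric])
  also have "\<dots> = - c" by (simp add: measure_uniform_cube_component[OF c] field_simps)
  finally show ?thesis by (simp add: c_def)
qed

text \<open>By linearity only the one-coordinate marginals of the uniform law enter.\<close>

lemma integral_inner_dithered_sign_vec:
  fixes z v :: "real ^ 'd"
  assumes G: "G > 0" and v: "\<And>j. \<bar>v $ j\<bar> \<le> G"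
  shows "(\<integral>u. z \<bullet> sign_vec (v + G *\<^sub>R u) \<partial>uniform_measure lborel cube) = (z \<bullet> v) / G"
proof -
  interpret prob_space "uniform_measure lborel (cube :: (real ^ 'd) set)"
    by (rule prob_space_uniform_cube)
  have int: "integrable (uniform_measure lborel cube) (\<lambda>u :: real ^ 'd. sgn (v $ j + G * u $ j))" for j
    by (rule integrable_const_bound[where B=1]) (auto simp: sgn_if)
  have "(\<integral>u. z \<bullet> sign_vec (v + G *\<^sub>R u) \<partial>uniform_measure lborel cube)
      = (\<integral>u. (\<Sum>j\<in>UNIV. z $ j * sgn (v $ j + G * u $ j)) \<partial>uniform_measure lborel cube)"
    by (simp add: inner_vec_def sign_vec_def)
  also have "\<dots> = (\<Sum>j\<in>UNIV. z $ j * (v $ j / G))"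
    using int by (simp add: Bochner_Integration.integral_sum integral_dithered_sgn[OF G v])
  finally show ?thesis by (simp add: inner_vec_def sum_divide_distrib)
qed

section \<open>Subgradients, averages and measurability of one update\<close>

text \<open>Duality of the l1 and sup norms: test the subgradient inequality at
  \<open>y + axis j s\<close> with s = 1 and s = -1, displacements of l1-norm 1. This puts every
  coordinate in the range where dithering is unbiased.\<close>

lemma subgradient_component_le:
  fixes h :: "real ^ 'd \<Rightarrow> real"
  assumes lip: "\<And>y z. \<bar>h y - h z\<bar> \<le> G * l1_norm (y - z)" and sub: "subgradient h y v"
  shows "\<bar>v $ j\<bar> \<le> G"
proof -
  have *: "s * v $ j \<le> G" if "\<bar>s\<bar> = 1" for s
  proof -
    have "s * v $ j = v \<bullet> (y + axis j s - y)" by (simp add: inner_axis mult.commute)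
    also have "\<dots> \<le> h (y + axis j s) - h y"
      using sub[unfolded subgradient_def, rule_format, of "y + axis j s"] by linarith
    also have "\<dots> \<le> G * l1_norm (y + axis j s - y)" using lip abs_le_D1 by blast
    also have "l1_norm (y + axis j s - y) = \<bar>s\<bar>"
      by (simp add: l1_norm_def axis_def if_distrib cong: if_cong)
    finally show ?thesis using that by simp
  qed
  show ?thesis using *[of 1] *[of "- 1"] by simp
qed

lemma convex_on_avg_fun:
  fixes f :: "nat \<Rightarrow> 'a::real_vector \<Rightarrow> real"
  assumes "\<And>i. i \<in> {1..n} \<Longrightarrow> convex_on UNIV (f i)"
  shows "convex_on UNIV (avg_fun n f)"
proof -
  \<comment> \<open>Generalised to subsets of \<open>{1..n}\<close> so that the induction over
    finite sets keeps every index within the convexity hypothesis.\<close>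
  have "convex_on UNIV (\<lambda>x. (1 / real n) * (\<Sum>i\<in>I. f i x))" if "finite I" "I \<subseteq> {1..n}" for I
  proof -
    have "convex_on UNIV (\<lambda>x. \<Sum>i\<in>I. f i x)"
      using that by (induction rule: finite_induct) (auto intro!: convex_on_add assms simp: convex_on_const)
    then show ?thesis by (intro convex_on_cmul) auto
  qed
  from this[of "{1..n}"] show ?thesis unfolding avg_fun_def by simp
qed

text \<open>Each \<open>S i\<close> is measurable separately; a random index with countably many
  values glues these maps together measurably.\<close>

lemma measurable_select:
  assumes S: "\<And>i. i \<in> {1..n} \<Longrightarrow> S i \<in> measurable L K"
    and J: "J \<in> measurable N (count_space {1..n :: nat})" and Z: "Z \<in> measurable N L"
  shows "(\<lambda>w. S (J w) (Z w)) \<in> measurable N K"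
proof (rule measurable_compose_countable'[where I = "{1..n}" and f = "\<lambda>i w. S i (Z w)", OF _ J])
  show "(\<lambda>w. S i (Z w)) \<in> measurable N K" if "i \<in> {1..n}" for i
    by (rule measurable_compose[OF Z S[OF that]])
qed simp

lemma measurable_dithered_step:
  fixes S :: "nat \<Rightarrow> real ^ 'd \<Rightarrow> real ^ 'd"
  assumes S: "\<And>i. i \<in> {1..n} \<Longrightarrow> S i \<in> borel_measurable borel"
    and [measurable]: "I \<in> measurable N (count_space {1..n})" "X \<in> borel_measurable N"
      "V \<in> borel_measurable N"
  shows "(\<lambda>w. sign_vec (S (I w) (X w) + G *\<^sub>R V w)) \<in> borel_measurable N"
proof -
  have [measurable]: "(\<lambda>w. S (I w) (X w)) \<in> borel_measurable N"
    by (rule measurable_select[OF S]) measurable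
  show ?thesis by measurable
qed

text \<open>Condition twice. Since \<open>I\<close> is uniform and independent of \<open>P\<close>,
  the average may be replaced by the sampled function; the subgradient inequality then brings in
  \<open>S\<close>. Since \<open>V\<close> is independent of \<open>(P, I)\<close>, the mean of the
  dithered sign is \<open>S / G\<close>, whence the factor \<open>G\<close>. Here \<open>P\<close>
  is the past and \<open>X\<close> reads the iterate off it.\<close>

lemma expectation_dithered_step:
  fixes S :: "nat \<Rightarrow> real ^ 'd \<Rightarrow> real ^ 'd" and f :: "nat \<Rightarrow> real ^ 'd \<Rightarrow> real"
    and X :: "'p \<Rightarrow> real ^ 'd"
  assumes M: "prob_space M" and n: "n \<ge> 1" and G: "G > 0"
    and meas_f: "\<And>i. i \<in> {1..n} \<Longrightarrow> f i \<in> borel_measurable borel"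
    and lip: "\<And>i y z. i \<in> {1..n} \<Longrightarrow> \<bar>f i y - f i z\<bar> \<le> G * l1_norm (y - z)"
    and meas_S: "\<And>i. i \<in> {1..n} \<Longrightarrow> S i \<in> borel_measurable borel"
    and sub: "\<And>i y. i \<in> {1..n} \<Longrightarrow> subgradient (f i) y (S i y)"
    and unif_I: "distr M (count_space {1..n}) I = uniform_count_measure {1..n}"
    and ind_I: "indep_rv M (count_space {1..n}) I L P"
    and unif_V: "distr M borel V = uniform_measure lborel cube"
    and ind_V: "indep_rv M borel V (L \<Otimes>\<^sub>M count_space {1..n}) (\<lambda>\<omega>. (P \<omega>, I \<omega>))"
    and X: "X \<in> borel_measurable L"
    and bound: "\<And>p. p \<in> space L \<Longrightarrow> norm (X p - y) \<le> B"
  shows "(\<integral>\<omega>. avg_fun n f (X (P \<omega>)) \<partial>M) - avg_fun n f y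
     \<le> G * (\<integral>\<omega>. (X (P \<omega>) - y) \<bullet> sign_vec (S (I \<omega>) (X (P \<omega>)) + G *\<^sub>R V \<omega>) \<partial>M)"
proof -
  interpret prob_space M by fact
  have [measurable]: "I \<in> measurable M (count_space {1..n})" "P \<in> measurable M L"
    using ind_I by (auto simp: indep_rv_def)
  note X[measurable]
  have l1: "l1_norm w \<le> real CARD('d) * norm w" for w :: "real ^ 'd"
  proof -
    have "l1_norm w \<le> (\<Sum>j\<in>(UNIV :: 'd set). norm w)"
      unfolding l1_norm_def by (intro sum_mono component_le_norm_cart)
    then show ?thesis by simp
  qed
  \<comment> \<open>Serves integrability only: it bounds differences of function values, via the
    comparison of the l1-norm with the dimension times the Euclidean norm, and also the inner
    products with the subgradient.\<close>
  define C where "C = G * (real CARD('d) * B)"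
  have f_bound: "\<bar>f i (X p) - f i y\<bar> \<le> C" if "i \<in> {1..n}" "p \<in> space L" for i p
  proof -
    have "G * l1_norm (X p - y) \<le> G * (real CARD('d) * B)"
      using G l1[of "X p - y"] bound[OF that(2)]
      by (intro mult_left_mono order_trans[OF l1] mult_left_mono) auto
    then show ?thesis using lip[OF that(1), of "X p" y] by (simp add: C_def)
  qed
  have space_P: "P \<omega> \<in> space L" "I \<omega> \<in> {1..n}" if "\<omega> \<in> space M" for \<omega>
    using measurable_space[OF \<open>P \<in> measurable M L\<close> that]
      measurable_space[OF \<open>I \<in> measurable M (count_space {1..n})\<close> that] by auto
  have S_le: "\<bar>S i w $ j\<bar> \<le> G" if "i \<in> {1..n}" for i w j
    by (rule subgradient_component_le[OF lip[OF that] sub[OF that]])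
  have meas_fI: "(\<lambda>w. f (J w) (Z w) - f (J w) y) \<in> borel_measurable N"
    if J: "J \<in> measurable N (count_space {1..n})" and Z: "Z \<in> borel_measurable N"
    for J and Z :: "'q \<Rightarrow> real ^ 'd" and N :: "'q measure"
    by (intro borel_measurable_diff measurable_select[OF meas_f J Z]
          measurable_select[OF meas_f J borel_measurable_const])
  have avg: "(\<integral>i. f i z - f i y \<partial>distr M (count_space {1..n}) I) = avg_fun n f z - avg_fun n f y" for z
    using n unfolding unif_I
    by (subst integral_uniform_count_measure)
       (auto simp: avg_fun_def sum_subtractf diff_divide_distrib)
  have meas_avg: "avg_fun n f \<in> borel_measurable borel"
    unfolding avg_fun_def using meas_f by (intro borel_measurable_times borel_measurable_sum) auto
  have avg_bound: "\<bar>avg_fun n f (X p) - avg_fun n f y\<bar> \<le> C" if "p \<in> space L" for p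
  proof -
    have "avg_fun n f (X p) - avg_fun n f y = (1 / real n) * (\<Sum>i=1..n. f i (X p) - f i y)"
      by (simp add: avg_fun_def sum_subtractf diff_divide_distrib)
    also have "\<bar>\<dots>\<bar> \<le> (1 / real n) * (\<Sum>i=1..n. \<bar>f i (X p) - f i y\<bar>)"
      unfolding abs_mult by (intro mult_mono sum_abs) auto
    also have "\<dots> \<le> (1 / real n) * (\<Sum>i=1..n. C)"
      by (intro mult_left_mono sum_mono f_bound that) auto
    also have "\<dots> = C" using n by simp
    finally show ?thesis .
  qed
  note meas_avg[measurable]
  have int_avg: "integrable M (\<lambda>\<omega>. avg_fun n f (X (P \<omega>)) - avg_fun n f y)"
    by (rule integrable_const_bound[where B=C]) (simp add: avg_bound space_P, measurable)
  have "(\<integral>\<omega>. avg_fun n f (X (P \<omega>)) \<partial>M) - avg_fun n f y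
      = (\<integral>\<omega>. avg_fun n f (X (P \<omega>)) - avg_fun n f y \<partial>M)"
    using Bochner_Integration.integrable_add[OF int_avg integrable_const[of "avg_fun n f y"]]
    by (simp add: prob_space)
  \<comment> \<open>First conditioning: \<open>avg\<close> writes the average as an integral over
    the law of \<open>I\<close>, and independence from \<open>P\<close> undoes that
    integral.\<close>
  also have "\<dots> = (\<integral>\<omega>. f (I \<omega>) (X (P \<omega>)) - f (I \<omega>) y \<partial>M)"
    unfolding avg[symmetric]
  proof (rule expectation_indep_rv[OF M ind_I, where C=C, symmetric])
    show "(\<lambda>(i, p). f i (X p) - f i y) \<in> borel_measurable (count_space {1..n} \<Otimes>\<^sub>M L)"
      unfolding case_prod_beta by (rule meas_fI) measurable
  qed (simp add: f_bound)
  \<comment> \<open>The form \<open>G * (_ / G)\<close> exposes the quotient that is the mean of the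
    dithered sign.\<close>
  also have "\<dots> \<le> (\<integral>\<omega>. G * (((X (P \<omega>) - y) \<bullet> S (I \<omega>) (X (P \<omega>))) / G) \<partial>M)"
  proof (rule integral_mono)
    show "integrable M (\<lambda>\<omega>. f (I \<omega>) (X (P \<omega>)) - f (I \<omega>) y)"
    proof (rule integrable_const_bound[where B=C])
      show "AE \<omega> in M. norm (f (I \<omega>) (X (P \<omega>)) - f (I \<omega>) y) \<le> C"
        unfolding real_norm_def by (intro AE_I2 f_bound space_P)
    qed (rule meas_fI, measurable)
    have [measurable]: "(\<lambda>\<omega>. S (I \<omega>) (X (P \<omega>))) \<in> borel_measurable M"
      by (rule measurable_select[OF meas_S]) measurable
    have "\<bar>(X (P \<omega>) - y) \<bullet> S (I \<omega>) (X (P \<omega>))\<bar> \<le> C" if w: "\<omega> \<in> space M" for \<omega>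
    proof -
      have "norm (S (I \<omega>) (X (P \<omega>))) \<le> (\<Sum>j\<in>(UNIV :: 'd set). \<bar>S (I \<omega>) (X (P \<omega>)) $ j\<bar>)"
        by (rule norm_le_l1_cart)
      also have "\<dots> \<le> (\<Sum>j\<in>(UNIV :: 'd set). G)" using S_le space_P[OF w] by (intro sum_mono) auto
      finally have "norm (S (I \<omega>) (X (P \<omega>))) \<le> real CARD('d) * G" by simp
      then have "norm (X (P \<omega>) - y) * norm (S (I \<omega>) (X (P \<omega>))) \<le> B * (real CARD('d) * G)"
        using bound[OF space_P(1)[OF w]] by (intro mult_mono) (auto intro: order_trans[OF norm_ge_zero])
      then show ?thesis
        using Cauchy_Schwarz_ineq2[of "X (P \<omega>) - y" "S (I \<omega>) (X (P \<omega>))"]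
        by (simp add: C_def mult_ac)
    qed
    then have "integrable M (\<lambda>\<omega>. (X (P \<omega>) - y) \<bullet> S (I \<omega>) (X (P \<omega>)))"
      by (intro integrable_const_bound[where B=C]) auto
    then show "integrable M (\<lambda>\<omega>. G * (((X (P \<omega>) - y) \<bullet> S (I \<omega>) (X (P \<omega>))) / G))"
      using G by simp
    fix \<omega> assume "\<omega> \<in> space M"
    then have "f (I \<omega>) y \<ge> f (I \<omega>) (X (P \<omega>)) + S (I \<omega>) (X (P \<omega>)) \<bullet> (y - X (P \<omega>))"
      using sub space_P unfolding subgradient_def by blast
    then show "f (I \<omega>) (X (P \<omega>)) - f (I \<omega>) y \<le> G * (((X (P \<omega>) - y) \<bullet> S (I \<omega>) (X (P \<omega>))) / G)"
      using G by (simp add: inner_diff_left inner_diff_right inner_commute)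
  qed
  also have "\<dots> = G * (\<integral>\<omega>. ((X (P \<omega>) - y) \<bullet> S (I \<omega>) (X (P \<omega>))) / G \<partial>M)"
    by (rule integral_mult_right_zero)
  also have "(\<integral>\<omega>. ((X (P \<omega>) - y) \<bullet> S (I \<omega>) (X (P \<omega>))) / G \<partial>M)
     = (\<integral>\<omega>. (\<integral>u. (X (P \<omega>) - y) \<bullet> sign_vec (S (I \<omega>) (X (P \<omega>)) + G *\<^sub>R u) \<partial>distr M borel V) \<partial>M)"
    unfolding unif_V
    by (intro Bochner_Integration.integral_cong refl integral_inner_dithered_sign_vec[symmetric] G S_le space_P)
  \<comment> \<open>Second conditioning: with the pair of past and index frozen, the uniform
    variable \<open>u\<close> is replaced by the actual noise \<open>V\<close>.\<close>
  also have "\<dots> = (\<integral>\<omega>. (X (P \<omega>) - y) \<bullet> sign_vec (S (I \<omega>) (X (P \<omega>)) + G *\<^sub>R V \<omega>) \<partial>M)"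
  proof -
    define h where "h = (\<lambda>(p, i) u. (X p - y) \<bullet> sign_vec (S i (X p) + G *\<^sub>R u))"
    have "(\<integral>\<omega>. h (P \<omega>, I \<omega>) (V \<omega>) \<partial>M) = (\<integral>\<omega>. (\<integral>u. h (P \<omega>, I \<omega>) u \<partial>distr M borel V) \<partial>M)"
    proof (rule expectation_indep_rv[OF M ind_V, where C = "B * sqrt (real CARD('d))"])
      have "(\<lambda>z. sign_vec (S (snd (snd z)) (X (fst (snd z))) + G *\<^sub>R fst z))
          \<in> borel_measurable (borel \<Otimes>\<^sub>M (L \<Otimes>\<^sub>M count_space {1..n}))"
        by (rule measurable_dithered_step[OF meas_S]) measurable
      then show "(\<lambda>(a, b). h b a) \<in> borel_measurable (borel \<Otimes>\<^sub>M (L \<Otimes>\<^sub>M count_space {1..n}))"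
        unfolding h_def case_prod_beta by measurable
      fix u b assume "b \<in> space (L \<Otimes>\<^sub>M count_space {1..n})"
      then obtain p i where b: "b = (p, i)" "p \<in> space L" by (auto simp: space_pair_measure)
      have "norm (X p - y) * norm (sign_vec (S i (X p) + G *\<^sub>R u)) \<le> B * sqrt (real CARD('d))"
        using bound[OF b(2)] norm_sign_vec_le
        by (intro mult_mono) (auto intro: order_trans[OF norm_ge_zero])
      then show "\<bar>h b u\<bar> \<le> B * sqrt (real CARD('d))"
        using Cauchy_Schwarz_ineq2[of "X p - y" "sign_vec (S i (X p) + G *\<^sub>R u)"]
        by (simp add: h_def b)
    qed
    then show ?thesis by (simp add: h_def)
  qed
  finally show ?thesis .
qed

subsection \<open>Iterates as functions of the past\<close>

text \<open>Steps are numbered from 1, so the value at index 0 is a dummy and the step from 0 to 1 is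
  void.\<close>

primrec signsgd_path ::
  "(nat \<Rightarrow> real ^ 'd \<Rightarrow> real ^ 'd) \<Rightarrow> real \<Rightarrow> real \<Rightarrow> real ^ 'd \<Rightarrow> nat \<Rightarrow>
    (nat \<Rightarrow> nat \<times> (real ^ 'd)) \<Rightarrow> real ^ 'd" where
  "signsgd_path S G \<gamma> x0 0 p = x0"
| "signsgd_path S G \<gamma> x0 (Suc t) p = signsgd_path S G \<gamma> x0 t p -
     (if t = 0 then 0 else
       \<gamma> *\<^sub>R sign_vec (S (fst (p t)) (signsgd_path S G \<gamma> x0 t p) + G *\<^sub>R snd (p t)))"

text \<open>An arbitrary \<open>J\<close> containing the indices read by the path lets the whole
  induction stay in one product space, although earlier iterates read fewer coordinates.\<close>

lemma measurable_signsgd_path: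
  fixes S :: "nat \<Rightarrow> real ^ 'd \<Rightarrow> real ^ 'd"
  assumes S: "\<And>i. i \<in> {1..n} \<Longrightarrow> S i \<in> borel_measurable borel" and "{1..<t} \<subseteq> J"
  shows "signsgd_path S G \<gamma> x0 t \<in> borel_measurable (PiM J (\<lambda>_. count_space {1..n} \<Otimes>\<^sub>M borel))"
  using assms(2)
proof (induction t)
  case 0
  have "signsgd_path S G \<gamma> x0 0 = (\<lambda>_. x0)" by auto
  then show ?case by simp
next
  case (Suc t)
  have "{1..<t} \<subseteq> J" using Suc.prems by (rule subset_trans[rotated]) auto
  note Suc.IH[OF this, measurable]
  show ?case
  proof (cases "t = 0")
    case True
    have "signsgd_path S G \<gamma> x0 (Suc 0) = (\<lambda>_. x0)" by auto
    with True show ?thesis by simp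
  next
    case False
    then have [measurable]: "(\<lambda>p. p t) \<in> measurable (PiM J (\<lambda>_. count_space {1..n} \<Otimes>\<^sub>M borel))
        (count_space {1..n} \<Otimes>\<^sub>M (borel :: (real ^ 'd) measure))"
      using Suc.prems by (intro measurable_component_singleton) auto
    have eq: "signsgd_path S G \<gamma> x0 (Suc t) = (\<lambda>p. signsgd_path S G \<gamma> x0 t p -
       \<gamma> *\<^sub>R sign_vec (S (fst (p t)) (signsgd_path S G \<gamma> x0 t p) + G *\<^sub>R snd (p t)))"
      using False by auto
    have "(\<lambda>p. sign_vec (S (fst (p t)) (signsgd_path S G \<gamma> x0 t p) + G *\<^sub>R snd (p t)))
        \<in> borel_measurable (PiM J (\<lambda>_. count_space {1..n} \<Otimes>\<^sub>M borel))"
      by (rule measurable_dithered_step[OF S]) measurable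
    then show ?thesis unfolding eq by measurable
  qed
qed

text \<open>Each update moves by at most \<open>\<bar>\<gamma>\<bar>\<close> times the square root
  of the dimension, whatever the randomness. This deterministic bound makes all later integrands
  bounded.\<close>

lemma norm_signsgd_path_diff_le:
  "norm (signsgd_path S G \<gamma> x0 t p - x0) \<le> real t * (\<bar>\<gamma>\<bar> * sqrt (real CARD('d)))"
  for x0 :: "real ^ 'd"
proof (induction t)
  case (Suc t)
  let ?s = "if t = 0 then 0 else
     \<gamma> *\<^sub>R sign_vec (S (fst (p t)) (signsgd_path S G \<gamma> x0 t p) + G *\<^sub>R snd (p t))"
  have "norm ?s \<le> \<bar>\<gamma>\<bar> * sqrt (real CARD('d))"
    using norm_sign_vec_le by (auto intro!: mult_left_mono)
  then have "norm (signsgd_path S G \<gamma> x0 t p - x0 - ?s)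
      \<le> real t * (\<bar>\<gamma>\<bar> * sqrt (real CARD('d))) + \<bar>\<gamma>\<bar> * sqrt (real CARD('d))"
    using Suc.IH norm_triangle_ineq4[of "signsgd_path S G \<gamma> x0 t p - x0" ?s] by linarith
  then show ?case by (simp add: algebra_simps)
qed simp

theorem theorem1:
  fixes n T :: nat
    and G \<gamma> :: real
    and f :: "nat \<Rightarrow> real ^ 'd \<Rightarrow> real"
    and S :: "nat \<Rightarrow> real ^ 'd \<Rightarrow> real ^ 'd"
    and x_init x_star :: "real ^ 'd"
    and M :: "'w measure"
    and idx :: "nat \<Rightarrow> 'w \<Rightarrow> nat"
    and U g x :: "nat \<Rightarrow> 'w \<Rightarrow> real ^ 'd"
  assumes n: "n \<ge> 1" and T: "T \<ge> 1" and G: "G > 0"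
    and convex: "\<And>i. i \<in> {1..n} \<Longrightarrow> convex_on UNIV (f i)"
    and lipschitz: "\<And>i y z. i \<in> {1..n} \<Longrightarrow> \<bar>f i y - f i z\<bar> \<le> G * l1_norm (y - z)"
    and minimizer: "\<And>y. avg_fun n f x_star \<le> avg_fun n f y"
    and step_size: "\<gamma> = norm (x_init - x_star) / sqrt (real (CARD('d)) * real T)"
    and selection_measurable: "\<And>i. i \<in> {1..n} \<Longrightarrow> S i \<in> borel_measurable borel"
    and selection_subgradient: "\<And>i y. i \<in> {1..n} \<Longrightarrow> subgradient (f i) y (S i y)"
    and prob_space: "prob_space M"
    and idx_measurable: "\<And>t. t \<in> {1..T} \<Longrightarrow> idx t \<in> measurable M (count_space {1..n})"
    and idx_uniform: "\<And>t. t \<in> {1..T} \<Longrightarrow>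
          distr M (count_space {1..n}) (idx t) = uniform_count_measure {1..n}"
    and idx_indep: "\<And>t. t \<in> {1..T} \<Longrightarrow>
          indep_rv M (count_space {1..n}) (idx t) (past_space n t) (past idx U t)"
    and U_measurable: "\<And>t. t \<in> {1..T} \<Longrightarrow> U t \<in> borel_measurable M"
    and U_uniform: "\<And>t. t \<in> {1..T} \<Longrightarrow> distr M borel (U t) = uniform_measure lborel cube"
    and U_indep: "\<And>t. t \<in> {1..T} \<Longrightarrow>
          indep_rv M borel (U t)
            (past_space n t \<Otimes>\<^sub>M count_space {1..n}) (\<lambda>\<omega>. (past idx U t \<omega>, idx t \<omega>))"
    and start: "\<And>\<omega>. \<omega> \<in> space M \<Longrightarrow> x 1 \<omega> = x_init"
    and gradient: "\<And>t \<omega>. t \<in> {1..T} \<Longrightarrow> \<omega> \<in> space M \<Longrightarrow> g t \<omega> = S (idx t \<omega>) (x t \<omega>)"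
    and step: "\<And>t \<omega>. t \<in> {1..T} \<Longrightarrow> \<omega> \<in> space M \<Longrightarrow>
          x (Suc t) \<omega> = x t \<omega> - \<gamma> *\<^sub>R sign_vec (g t \<omega> + G *\<^sub>R U t \<omega>)"
  shows "integrable M (\<lambda>\<omega>. avg_fun n f (avg_iterate T x \<omega>)) \<and>
         prob_space.expectation M (\<lambda>\<omega>. avg_fun n f (avg_iterate T x \<omega>)) - avg_fun n f x_star
           \<le> G * norm (x_init - x_star) * sqrt (real (CARD('d)) / real T)"
proof -
  interpret prob_space M by fact
  define d where "d = real CARD('d)"
  define D where "D = norm (x_init - x_star)"
  define F where "F = avg_fun n f"
  define X where "X = signsgd_path S G \<gamma> x_init"
  define s where "s t \<omega> = sign_vec (g t \<omega> + G *\<^sub>R U t \<omega>)" for t \<omega>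
  have d: "d > 0" by (simp add: d_def)
  have T0: "real T > 0" using T by simp
  have \<gamma>: "\<gamma> = D / sqrt (d * real T)" by (simp add: step_size D_def d_def)
  have D0: "D \<ge> 0" by (simp add: D_def)
  \<comment> \<open>Stated for every later horizon \<open>t'\<close>: the step to
    \<open>Suc t\<close> needs the entry at \<open>t\<close>, which the past truncated at
    \<open>t\<close> itself does not contain.\<close>
  have X_past: "t' \<ge> t \<Longrightarrow> x t \<omega> = X t (past idx U t' \<omega>)"
    if "t \<in> {1..T}" and w: "\<omega> \<in> space M" for t t' \<omega>
    using that(1)
  proof (induction t arbitrary: t')
    case (Suc t)
    show ?case
    proof (cases "t = 0")
      case True
      then show ?thesis using start[OF w] by (simp add: X_def)
    next
      case False
      then have t: "t \<in> {1..T}" using Suc.prems by auto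
      have "x t \<omega> = X t (past idx U t' \<omega>)" using Suc t by auto
      moreover have "past idx U t' \<omega> t = (idx t \<omega>, U t \<omega>)" using Suc.prems t by (simp add: past_def)
      ultimately show ?thesis
        using False by (simp add: step[OF t w] gradient[OF t w] X_def)
    qed
  qed simp
  have X_meas: "X t \<in> borel_measurable (past_space n t)" for t
    unfolding X_def past_space_def by (rule measurable_signsgd_path[OF selection_measurable]) auto
  have past_meas: "past idx U t \<in> measurable M (past_space n t)" if "t \<in> {1..T}" for t
    using idx_indep[OF that] by (simp add: indep_rv_def)
  \<comment> \<open>Measurability of the iterates is derived from their representation through the
    past; the equality holds only on \<open>space M\<close>.\<close>
  have x_meas: "x t \<in> borel_measurable M" if "t \<in> {1..T}" for t
  proof -
    have "(\<lambda>\<omega>. X t (past idx U t \<omega>)) \<in> borel_measurable M"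
      by (rule measurable_compose[OF past_meas[OF that] X_meas])
    then show ?thesis by (rule measurable_cong[THEN iffD2, rotated]) (use X_past[OF that] in auto)
  qed
  \<comment> \<open>At most \<open>T\<close> updates of bounded length, plus the initial distance.
    If \<open>D = 0\<close> then \<open>\<gamma> = 0\<close> and \<open>B = 0\<close>, which settles
    the degenerate case of \<open>E_le\<close>.\<close>
  define B where "B = real T * (\<bar>\<gamma>\<bar> * sqrt d) + D"
  have X_bound: "norm (X t p - x_star) \<le> B" if "t \<in> {1..T}" for t p
  proof -
    have "norm (X t p - x_init) \<le> real t * (\<bar>\<gamma>\<bar> * sqrt d)"
      unfolding X_def d_def by (rule norm_signsgd_path_diff_le)
    also have "\<dots> \<le> real T * (\<bar>\<gamma>\<bar> * sqrt d)" using that d by (intro mult_right_mono) auto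
    finally show ?thesis
      using norm_triangle_ineq[of "X t p - x_init" "x_init - x_star"] by (simp add: B_def D_def)
  qed
  have x_bound: "norm (x t \<omega> - x_star) \<le> B" if "t \<in> {1..T}" "\<omega> \<in> space M" for t \<omega>
    using X_past[OF that order_refl] X_bound[OF that(1)] by simp
  have convF: "convex_on UNIV F" unfolding F_def by (rule convex_on_avg_fun[OF convex])
  have contF: "continuous_on UNIV F" by (rule convex_on_continuous[OF open_UNIV convF])
  have F_meas[measurable]: "F \<in> borel_measurable borel"
    by (rule borel_measurable_continuous_onI[OF contF])
  have f_meas: "f i \<in> borel_measurable borel" if "i \<in> {1..n}" for i
    by (rule borel_measurable_continuous_onI[OF convex_on_continuous[OF open_UNIV convex[OF that]]])
  \<comment> \<open>A finite convex function on the whole space is continuous, hence bounded on the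
    ball that contains the iterates and, by convexity of the ball, their average. This gives
    integrability of \<open>F\<close> along both.\<close>
  have "compact (F ` cball x_star B)"
    by (intro compact_continuous_image continuous_on_subset[OF contF]) auto
  then obtain K where K: "\<And>z. norm (z - x_star) \<le> B \<Longrightarrow> \<bar>F z\<bar> \<le> K"
    using compact_imp_bounded[of "F ` cball x_star B"]
    by (force simp: bounded_iff dist_norm norm_minus_commute)
  have int_F: "integrable M (\<lambda>\<omega>. F (Z \<omega>))"
    if "Z \<in> borel_measurable M" "\<And>\<omega>. \<omega> \<in> space M \<Longrightarrow> norm (Z \<omega> - x_star) \<le> B" for Z
    by (rule integrable_const_bound[where B=K]) (use that K in auto)
  let ?a = "avg_iterate T x"
  have a_eq: "?a \<omega> = (\<Sum>t=1..T. (1 / real T) *\<^sub>R x t \<omega>)" for \<omega>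
    by (simp add: avg_iterate_def scaleR_sum_right)
  have a_meas: "?a \<in> borel_measurable M"
    unfolding avg_iterate_def using x_meas by (intro borel_measurable_scaleR borel_measurable_sum) auto
  have a_bound: "norm (?a \<omega> - x_star) \<le> B" if w: "\<omega> \<in> space M" for \<omega>
  proof -
    have "(\<Sum>t=1..T. (1 / real T) *\<^sub>R x t \<omega>) \<in> cball x_star B"
      by (rule convex_sum) (use T x_bound[OF _ w] in \<open>auto simp: dist_norm norm_minus_commute\<close>)
    then show ?thesis by (simp add: a_eq dist_norm norm_minus_commute)
  qed
  have jensen: "F (?a \<omega>) \<le> (\<Sum>t=1..T. (1 / real T) * F (x t \<omega>))" for \<omega>
    unfolding a_eq by (rule convex_on_sum[OF _ _ convF]) (use T in auto)
  have int_x: "integrable M (\<lambda>\<omega>. F (x t \<omega>))" if "t \<in> {1..T}" for t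
    by (rule int_F[OF x_meas[OF that] x_bound[OF that]])
  have int_a: "integrable M (\<lambda>\<omega>. F (?a \<omega>))" by (rule int_F[OF a_meas a_bound])
  have s_eq: "s t \<omega> = sign_vec (S (idx t \<omega>) (x t \<omega>) + G *\<^sub>R U t \<omega>)"
    if "t \<in> {1..T}" "\<omega> \<in> space M" for t \<omega>
    using gradient[OF that] by (simp add: s_def)
  have s_meas: "s t \<in> borel_measurable M" if t: "t \<in> {1..T}" for t
    using measurable_dithered_step[OF selection_measurable idx_measurable[OF t] x_meas[OF t] U_measurable[OF t]]
    by (rule measurable_cong[THEN iffD2, rotated]) (use s_eq[OF t] in auto)
  have int_s: "integrable M (\<lambda>\<omega>. (x t \<omega> - x_star) \<bullet> s t \<omega>)" if t: "t \<in> {1..T}" for t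
  proof (rule integrable_const_bound[where B = "B * sqrt d"])
    show "AE \<omega> in M. norm ((x t \<omega> - x_star) \<bullet> s t \<omega>) \<le> B * sqrt d"
    proof (rule AE_I2)
      fix \<omega> assume w: "\<omega> \<in> space M"
      have "norm (x t \<omega> - x_star) * norm (s t \<omega>) \<le> B * sqrt d"
        unfolding s_def d_def using x_bound[OF t w]
        by (intro mult_mono norm_sign_vec_le) (auto intro: order_trans[OF norm_ge_zero])
      then show "norm ((x t \<omega> - x_star) \<bullet> s t \<omega>) \<le> B * sqrt d"
        using Cauchy_Schwarz_ineq2[of "x t \<omega> - x_star" "s t \<omega>"] by simp
    qed
  qed (use x_meas[OF t] s_meas[OF t] in \<open>auto intro: borel_measurable_inner\<close>)
  \<comment> \<open>Rewriting \<open>x t\<close> as \<open>X t\<close> of the past makes the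
    independence hypotheses applicable.\<close>
  have step_E: "(\<integral>\<omega>. F (x t \<omega>) \<partial>M) - F x_star \<le> G * (\<integral>\<omega>. (x t \<omega> - x_star) \<bullet> s t \<omega> \<partial>M)"
    if t: "t \<in> {1..T}" for t
  proof -
    have "(\<integral>\<omega>. F (x t \<omega>) \<partial>M) = (\<integral>\<omega>. F (X t (past idx U t \<omega>)) \<partial>M)"
      by (rule Bochner_Integration.integral_cong) (use X_past[OF t _ order_refl] in auto)
    moreover have "(\<integral>\<omega>. (x t \<omega> - x_star) \<bullet> s t \<omega> \<partial>M)
      = (\<integral>\<omega>. (X t (past idx U t \<omega>) - x_star)
            \<bullet> sign_vec (S (idx t \<omega>) (X t (past idx U t \<omega>)) + G *\<^sub>R U t \<omega>) \<partial>M)"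
      by (rule Bochner_Integration.integral_cong) (use X_past[OF t _ order_refl] s_eq[OF t] in auto)
    ultimately show ?thesis
      using expectation_dithered_step[OF prob_space_axioms n G f_meas lipschitz selection_measurable
        selection_subgradient idx_uniform[OF t] idx_indep[OF t] U_uniform[OF t] U_indep[OF t]
        X_meas X_bound[OF t]]
      by (simp add: F_def)
  qed

  \<comment> \<open>Descent in squared distance\<close>
  have expand: "(norm (v - \<gamma> *\<^sub>R w))\<^sup>2 = (norm v)\<^sup>2 - 2 * \<gamma> * (v \<bullet> w) + \<gamma>\<^sup>2 * (norm w)\<^sup>2"
    for v w :: "real ^ 'd"
    unfolding power2_norm_eq_inner
    by (simp add: inner_diff_left inner_diff_right inner_commute power2_eq_square algebra_simps)
  \<comment> \<open>The subtracted squared distance carries the induction and is dropped once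
    \<open>k = T\<close>. The base case reads \<open>x (Suc 0)\<close>, the starting point.\<close>
  have telescope: "2 * \<gamma> * (\<Sum>t=1..k. (x t \<omega> - x_star) \<bullet> s t \<omega>)
      \<le> D\<^sup>2 + \<gamma>\<^sup>2 * d * real k - (norm (x (Suc k) \<omega> - x_star))\<^sup>2"
    if "k \<le> T" and w: "\<omega> \<in> space M" for k \<omega>
    using that(1)
  proof (induction k)
    case 0
    then show ?case using start[OF w] by (simp add: D_def)
  next
    case (Suc k)
    then have t: "Suc k \<in> {1..T}" by auto
    have "x (Suc (Suc k)) \<omega> - x_star = (x (Suc k) \<omega> - x_star) - \<gamma> *\<^sub>R s (Suc k) \<omega>"
      using step[OF t w] by (simp add: s_def)
    then have "(norm (x (Suc (Suc k)) \<omega> - x_star))\<^sup>2 = (norm (x (Suc k) \<omega> - x_star))\<^sup>2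
        - 2 * \<gamma> * ((x (Suc k) \<omega> - x_star) \<bullet> s (Suc k) \<omega>) + \<gamma>\<^sup>2 * (norm (s (Suc k) \<omega>))\<^sup>2"
      by (simp only: expand)
    moreover have "\<gamma>\<^sup>2 * (norm (s (Suc k) \<omega>))\<^sup>2 \<le> \<gamma>\<^sup>2 * d"
      unfolding s_def d_def by (intro mult_left_mono norm_sign_vec_power2_le) simp
    ultimately show ?case using Suc by (simp add: algebra_simps)
  qed
  define E where "E = (\<Sum>t=1..T. \<integral>\<omega>. (x t \<omega> - x_star) \<bullet> s t \<omega> \<partial>M)"
  have "2 * \<gamma> * E = (\<integral>\<omega>. 2 * \<gamma> * (\<Sum>t=1..T. (x t \<omega> - x_star) \<bullet> s t \<omega>) \<partial>M)"
    unfolding E_def using int_s by (simp add: Bochner_Integration.integral_sum)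
  also have "\<dots> \<le> (\<integral>\<omega>. D\<^sup>2 + \<gamma>\<^sup>2 * d * real T \<partial>M)"
  proof (rule integral_mono)
    show "integrable M (\<lambda>\<omega>. 2 * \<gamma> * (\<Sum>t=1..T. (x t \<omega> - x_star) \<bullet> s t \<omega>))"
      using int_s by (intro integrable_mult_right Bochner_Integration.integrable_sum) auto
    fix \<omega> assume "\<omega> \<in> space M"
    from telescope[OF order_refl this]
    show "2 * \<gamma> * (\<Sum>t=1..T. (x t \<omega> - x_star) \<bullet> s t \<omega>) \<le> D\<^sup>2 + \<gamma>\<^sup>2 * d * real T"
      using zero_le_power2[of "norm (x (Suc T) \<omega> - x_star)"] by linarith
  qed simp
  also have "\<dots> = D\<^sup>2 + \<gamma>\<^sup>2 * d * real T" by (simp add: prob_space)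
  \<comment> \<open>The step size is chosen to balance the two terms of the bound.\<close>
  also have "\<gamma>\<^sup>2 * d * real T = D\<^sup>2" using d T0 by (simp add: \<gamma> power_divide)
  finally have E_D: "\<gamma> * E \<le> D\<^sup>2" by simp
  \<comment> \<open>Division by \<open>\<gamma>\<close> needs \<open>D > 0\<close>. For
    \<open>D = 0\<close> the bound \<open>E_D\<close> is vacuous, but then \<open>B = 0\<close> pins
    every iterate to \<open>x_star\<close> and \<open>E\<close> vanishes.\<close>
  have E_le: "E \<le> D * sqrt (d * real T)"
  proof (cases "D = 0")
    case True
    have "(x t \<omega> - x_star) = 0" if "t \<in> {1..T}" "\<omega> \<in> space M" for t \<omega>
      using x_bound[OF that] True by (simp add: B_def \<gamma>)
    then have "E = (\<Sum>t=1..T. \<integral>\<omega>. 0 \<partial>M)"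
      unfolding E_def by (intro sum.cong Bochner_Integration.integral_cong refl) auto
    then show ?thesis using True by simp
  next
    case False
    then have "D > 0" using D0 by simp
    then show ?thesis using E_D d T0 by (simp add: \<gamma> power2_eq_square field_simps)
  qed

  \<comment> \<open>From the iterates to their average\<close>
  have "(\<integral>\<omega>. F (?a \<omega>) \<partial>M) \<le> (\<integral>\<omega>. (\<Sum>t=1..T. (1 / real T) * F (x t \<omega>)) \<partial>M)"
    using int_x by (intro integral_mono int_a jensen Bochner_Integration.integrable_sum integrable_mult_right) auto
  also have "\<dots> = (\<Sum>t=1..T. (1 / real T) * (\<integral>\<omega>. F (x t \<omega>) \<partial>M))"
    using int_x by (subst Bochner_Integration.integral_sum) auto
  also have "\<dots> \<le> (\<Sum>t=1..T. (1 / real T) * (F x_star + G * (\<integral>\<omega>. (x t \<omega> - x_star) \<bullet> s t \<omega> \<partial>M)))"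
  proof (intro sum_mono mult_left_mono)
    fix t assume "t \<in> {1..T}"
    from step_E[OF this]
    show "(\<integral>\<omega>. F (x t \<omega>) \<partial>M) \<le> F x_star + G * (\<integral>\<omega>. (x t \<omega> - x_star) \<bullet> s t \<omega> \<partial>M)" by linarith
  qed simp
  also have "\<dots> = F x_star + G * E / real T"
    using T0 by (simp add: sum_distrib_left[symmetric] sum.distrib E_def distrib_left sum_divide_distrib[symmetric] add_divide_distrib)
  also have "G * E / real T \<le> G * (D * sqrt (d * real T)) / real T"
    using E_le G T0 by (intro divide_right_mono mult_left_mono) auto
  also have "G * (D * sqrt (d * real T)) / real T = G * D * sqrt (d / real T)"
    using T0 by (simp add: real_sqrt_mult real_sqrt_divide real_div_sqrt field_simps)
  finally show ?thesis using int_a by (simp add: F_def D_def d_def)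
qed

end
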